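(* Let $U=(u_{ij})_{i,j\in\mathbb{Z}}$ be a $\mathbb{Z}\times\mathbb{Z}$ matrix whose scalar entries depend on $t_{\pm1},t_{\pm2},\ldots$, and put $g=E-U\Omega$, $\bar g=E-U\bar\Omega$, and let $\eta^{(2)}=(\,g\mid\bar g\,)$ be the $\mathbb{Z}\times(\mathbb{Z}\sqcup\mathbb{Z})$ matrix obtained by placing $g$ and $\bar g$ side by side. Then the extended system $$\frac{\partial U}{\partial t_{\pm k}}=\Lambda^{\pm k}U-U\Lambda^{\mp k}-U\mathcal{O}_{\pm k}U,\qquad k=1,2,\ldots,$$ is equivalent to the system $$\frac{\partial g}{\partial t_{\pm k}}=(\Lambda^{\pm k}-U\mathcal{O}_{\pm k})g-g\Lambda^{\pm k},\qquad \frac{\partial\bar g}{\partial t_{\pm k}}=(\Lambda^{\pm k}-U\mathcal{O}_{\pm k})\bar g-\bar g\Lambda^{\pm k},\qquad k=1,2,\ldots,$$ that is, to $$\frac{\partial\eta^{(2)}}{\partial t_{\pm k}}=(\Lambda^{\pm k}-U\mathcal{O}_{\pm k})\eta^{(2)}-\eta^{(2)}\,\mathrm{diag}(\Lambda^{\pm k},\Lambda^{\pm k}),\qquad k=1,2,\ldots.$$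
   Context: $E_{ij}$ is the $\mathbb{Z}\times\mathbb{Z}$ matrix unit and $E$ the unit matrix. For $k\in\mathbb{Z}$, $\Lambda^k=\sum_{i\in\mathbb{Z}}E_{i,i+k}$. For $k\ge1$, $\mathcal{O}_k=\sum_{i=0}^{k-1}E_{i,k-i-1}$ and $\mathcal{O}_{-k}=-\sum_{l=1}^kE_{-l,l-k-1}$. $\Omega=\sum_{i=0}^\infty E_{i,-i-1}$ and $\bar\Omega=-\sum_{i=0}^\infty E_{-i-1,i}$. $\mathrm{diag}(\Lambda^k,\Lambda^k)$ is the block-diagonal $(\mathbb{Z}\sqcup\mathbb{Z})\times(\mathbb{Z}\sqcup\mathbb{Z})$ matrix with two diagonal blocks $\Lambda^k$. All products involve only finite sums in each entry; derivatives are entrywise. *)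

theory Defs
  imports Complex_Main "HOL-Library.Groups_Big_Fun"
begin

text \<open>
  Matrices are functions of a row and a column index; sums, differences and negatives of
  matrices are the pointwise operations on functions.
\<close>

type_synonym ('r, 'c, 'a) mat = "'r \<Rightarrow> 'c \<Rightarrow> 'a"

text \<open>
  \<^const>\<open>Sum_any\<close> is the sum of all nonzero terms. It is \<open>0\<close> by convention if there are
  infinitely many of them, so products are meaningful only when every entry is a finite sum;
  this is the case for all products formed with the matrices below.
\<close>

definition mat_mult :: "('r, 'm, 'a::comm_ring_1) mat \<Rightarrow> ('m, 'c, 'a) mat \<Rightarrow> ('r, 'c, 'a) mat"
    (infixl "\<star>" 70) where
  "A \<star> B = (\<lambda>i j. Sum_any (\<lambda>m. A i m * B m j))"

definition unit_mat :: "(int, int, 'a::comm_ring_1) mat" where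
  "unit_mat = (\<lambda>i j. if i = j then 1 else 0)"

definition matrix_unit :: "int \<Rightarrow> int \<Rightarrow> (int, int, 'a::comm_ring_1) mat" where
  "matrix_unit a b = (\<lambda>i j. if i = a \<and> j = b then 1 else 0)"

definition Lambda :: "int \<Rightarrow> (int, int, 'a::comm_ring_1) mat" ("\<Lambda>\<^bsub>_\<^esub>") where
  "\<Lambda>\<^bsub>k\<^esub> = (\<lambda>a b. Sum_any (\<lambda>i. matrix_unit i (i + k) a b))"

text \<open>
  For negative index \<open>-k\<close> the summand is \<open>E\<^bsub>-l, l-k-1\<^esub>\<close>; in terms of the index \<open>n = -k\<close> itself
  the range is \<open>1..-n\<close> and the column is \<open>l + n - 1\<close>. The index \<open>0\<close> is never used.
\<close>

definition Omat :: "int \<Rightarrow> (int, int, 'a::comm_ring_1) mat" ("\<O>\<^bsub>_\<^esub>") where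
  "\<O>\<^bsub>n\<^esub> = (if n \<ge> 1
      then (\<lambda>a b. \<Sum>i\<in>{0..n - 1}. matrix_unit i (n - i - 1) a b)
      else (\<lambda>a b. - (\<Sum>l\<in>{1..- n}. matrix_unit (- l) (l + n - 1) a b)))"

definition Omega :: "(int, int, 'a::comm_ring_1) mat" where
  "Omega = (\<lambda>a b. Sum_any (\<lambda>i::nat. matrix_unit (int i) (- int i - 1) a b))"

definition Omega_bar :: "(int, int, 'a::comm_ring_1) mat" where
  "Omega_bar = (\<lambda>a b. - Sum_any (\<lambda>i::nat. matrix_unit (- int i - 1) (int i) a b))"

definition side_by_side ::
    "('r, 'c, 'a) mat \<Rightarrow> ('r, 'd, 'a) mat \<Rightarrow> ('r, 'c + 'd, 'a) mat" where
  "side_by_side A B = (\<lambda>i. case_sum (A i) (B i))"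

fun block_diag ::
    "('r, 'c, 'a::zero) mat \<Rightarrow> ('s, 'd, 'a) mat \<Rightarrow> ('r + 's, 'c + 'd, 'a) mat" where
  "block_diag A B (Inl i) (Inl j) = A i j"
| "block_diag A B (Inl i) (Inr j) = 0"
| "block_diag A B (Inr i) (Inl j) = 0"
| "block_diag A B (Inr i) (Inr j) = B i j"

text \<open>
  A point \<open>t\<close> collects the variables \<open>t\<^bsub>n\<^esub>\<close> for \<open>n \<noteq> 0\<close>; there is no variable of index \<open>0\<close>, and
  that coordinate is pinned to \<open>0\<close>. A domain only has to be open along every coordinate line,
  which is what partial derivatives require. This covers the whole space as well as domains
  that are not open in the product topology.
\<close>

definition time_domain :: "(int \<Rightarrow> 'a::real_normed_field) set \<Rightarrow> bool" where
  "time_domain D \<longleftrightarrow>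
     (\<forall>t\<in>D. t 0 = 0) \<and> (\<forall>t\<in>D. \<forall>n. n \<noteq> 0 \<longrightarrow> open {s. t(n := s) \<in> D})"

definition has_time_derivative ::
    "((int \<Rightarrow> 'a::real_normed_field) \<Rightarrow> ('r, 'c, 'a) mat) \<Rightarrow> int \<Rightarrow> (int \<Rightarrow> 'a) \<Rightarrow>
      ('r, 'c, 'a) mat \<Rightarrow> bool" where
  "has_time_derivative F n t F' \<longleftrightarrow>
     (\<forall>i j. ((\<lambda>s. F (t(n := s)) i j) has_field_derivative F' i j) (at (t n)))"

definition g_mat :: "('t \<Rightarrow> (int, int, 'a::comm_ring_1) mat) \<Rightarrow> 't \<Rightarrow> (int, int, 'a) mat" where
  "g_mat U = (\<lambda>t. unit_mat - U t \<star> Omega)"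

definition g_bar :: "('t \<Rightarrow> (int, int, 'a::comm_ring_1) mat) \<Rightarrow> 't \<Rightarrow> (int, int, 'a) mat" where
  "g_bar U = (\<lambda>t. unit_mat - U t \<star> Omega_bar)"

definition eta2 ::
    "('t \<Rightarrow> (int, int, 'a::comm_ring_1) mat) \<Rightarrow> 't \<Rightarrow> (int, int + int, 'a) mat" where
  "eta2 U = (\<lambda>t. side_by_side (g_mat U t) (g_bar U t))"

end

(*
  Both dressing matrices W = Omega, Omega_bar are supported on the antidiagonal b = -a-1 and
  satisfy the same relation W \<star> \<Lambda>\<^bsub>n\<^esub> - \<Lambda>\<^bsub>-n\<^esub> \<star> W = \<O>\<^bsub>n\<^esub>. This turns the right-hand side of the equation for
  E - U \<star> W into -V \<star> W, where V is the right-hand side of the equation for U. Conversely,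
  U \<star> Omega and U \<star> Omega_bar together contain every column of U exactly once up to sign, so
  the two equations for g and g_bar recover the one for U.
*)
theory Submission
  imports Defs
begin

lemma Sum_any_single:
  assumes "\<And>x. x \<noteq> p \<Longrightarrow> f x = 0"
  shows "Sum_any f = f p"
  using assms by (subst Sum_any.expand_superset[of "{p}"]) auto

lemma mat_mult_single_column:
  assumes "\<And>m. m \<noteq> p \<Longrightarrow> B m j = 0"
  shows "(A \<star> B) i j = A i p * B p j"
  unfolding mat_mult_def by (rule Sum_any_single) (simp add: assms)

lemma mat_mult_single_row:
  assumes "\<And>m. m \<noteq> p \<Longrightarrow> A i m = 0"
  shows "(A \<star> B) i j = A i p * B p j"
  unfolding mat_mult_def by (rule Sum_any_single) (simp add: assms)

text \<open>\<open>Sum_any\<close> returns 0 on an infinite support, so additivity can fail in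
  general. The finite row supports confine all three sums to one finite set, whatever
  \<open>C\<close> is.\<close>

lemma mat_mult_diff_left:
  assumes "finite {m. A i m \<noteq> 0}" "finite {m. B i m \<noteq> 0}"
  shows "((A - B) \<star> C) i j = (A \<star> C) i j - (B \<star> C) i j"
proof -
  let ?F = "{m. A i m \<noteq> 0} \<union> {m. B i m \<noteq> 0}"
  have "finite ?F"
    using assms by blast
  then show ?thesis
    unfolding mat_mult_def fun_diff_def
    by (subst (1 2 3) Sum_any.expand_superset[of ?F])
      (auto simp: left_diff_distrib sum_subtractf)
qed

lemma mat_mult_diff_right:
  assumes "finite {m. A i m \<noteq> 0}"
  shows "(A \<star> (B - C)) i j = (A \<star> B) i j - (A \<star> C) i j"
  unfolding mat_mult_def fun_diff_def
  by (subst (1 2 3) Sum_any.expand_superset[OF assms])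
    (auto simp: right_diff_distrib sum_subtractf)

lemma mat_mult_unit_right: "A \<star> unit_mat = A"
proof (intro ext)
  fix i j
  show "(A \<star> unit_mat) i j = A i j"
    by (subst mat_mult_single_column[of j]) (auto simp: unit_mat_def)
qed

lemma Lambda_entry: "\<Lambda>\<^bsub>k\<^esub> a b = (if b = a + k then 1 else 0)"
  unfolding Lambda_def by (subst Sum_any_single[of a]) (auto simp: matrix_unit_def)

lemma Omega_entry: "Omega a b = (if 0 \<le> a \<and> b = - a - 1 then 1 else 0)"
  unfolding Omega_def by (subst Sum_any_single[of "nat a"]) (auto simp: matrix_unit_def)

lemma Omega_bar_entry: "Omega_bar a b = (if a < 0 \<and> b = - a - 1 then - 1 else 0)"
  \<comment> \<open>The column fixes the summation index, i = b. For b < 0 the witness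
    \<open>nat b\<close> is 0, and that term vanishes as well.\<close>
  unfolding Omega_bar_def by (subst Sum_any_single[of "nat b"]) (auto simp: matrix_unit_def)

text \<open>The difference of indicators is 1 on 0 <= a < n, -1 on n <= a < 0 and 0 elsewhere. This
  merges both signs of n into one formula, so later arguments need no case split.\<close>

lemma Omat_entry:
  "\<O>\<^bsub>n\<^esub> a b = (if b = n - a - 1 then of_bool (0 \<le> a) - of_bool (n \<le> a) else 0)"
proof (cases "n \<ge> 1")
  case True
  have "\<O>\<^bsub>n\<^esub> a b = (\<Sum>i\<in>{0..n - 1}. if i = a then of_bool (b = n - a - 1) else 0)"
    unfolding Omat_def if_P[OF True] by (rule sum.cong) (auto simp: matrix_unit_def)
  then show ?thesis
    using True by auto
next
  case False
  have "\<O>\<^bsub>n\<^esub> a b = - (\<Sum>l\<in>{1..- n}. if l = - a then of_bool (b = n - a - 1) else 0)"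
    unfolding Omat_def if_not_P[OF False]
    by (rule arg_cong[where f = uminus], rule sum.cong) (auto simp: matrix_unit_def)
  then show ?thesis
    using False by auto
qed

lemma mat_mult_Lambda: "(A \<star> \<Lambda>\<^bsub>k\<^esub>) i j = A i (j - k)"
  by (subst mat_mult_single_column[of "j - k"]) (auto simp: Lambda_entry)

lemma Lambda_mat_mult: "(\<Lambda>\<^bsub>k\<^esub> \<star> A) i j = A (i + k) j"
  by (subst mat_mult_single_row[of "i + k"]) (auto simp: Lambda_entry)

lemma mat_mult_Omat: "(A \<star> \<O>\<^bsub>n\<^esub>) i j = A i (n - j - 1) * \<O>\<^bsub>n\<^esub> (n - j - 1) j"
  by (rule mat_mult_single_column) (auto simp: Omat_entry)

lemma finite_row_Lambda: "finite {m. (\<Lambda>\<^bsub>k\<^esub> :: (int, int, 'a::comm_ring_1) mat) i m \<noteq> 0}"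
  by (rule finite_subset[of _ "{i + k}"]) (auto simp: Lambda_entry)

text \<open>Only the columns 0..n-1 (for n > 0) or n..-1 (for n < 0) of O_n are nonzero; the
  interval below is a crude cover of both. Hence U O_n U has finite sums for arbitrary U.\<close>

lemma finite_row_mat_mult_Omat: "finite {m. (A \<star> \<O>\<^bsub>n\<^esub>) i m \<noteq> 0}"
proof (rule finite_subset)
  show "{m. (A \<star> \<O>\<^bsub>n\<^esub>) i m \<noteq> 0} \<subseteq> {- \<bar>n\<bar> - 1..\<bar>n\<bar>}"
    by (auto simp: mat_mult_Omat Omat_entry of_bool_def split: if_splits)
qed simp

text \<open>The feature shared by \<open>Omega\<close> and \<open>Omega_bar\<close>: right
  multiplication by such a W reflects column indices by j -> -j-1 and scales each column, so U W is
  defined for every U.\<close>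

definition antidiagonal :: "(int, int, 'a::zero) mat \<Rightarrow> bool" where
  "antidiagonal W \<longleftrightarrow> (\<forall>a b. b \<noteq> - a - 1 \<longrightarrow> W a b = 0)"

lemma mat_mult_antidiagonal:
  assumes "antidiagonal W"
  shows "(A \<star> W) i j = A i (- j - 1) * W (- j - 1) j"
  by (rule mat_mult_single_column) (use assms in \<open>auto simp: antidiagonal_def\<close>)

lemma antidiagonal_Omega: "antidiagonal Omega"
  by (auto simp: antidiagonal_def Omega_entry)

lemma antidiagonal_Omega_bar: "antidiagonal Omega_bar"
  by (auto simp: antidiagonal_def Omega_bar_entry)

text \<open>Both products live on b = n-a-1, one with the indicator of a >= 0 and the other with
  that of a >= n.\<close>

lemma Omega_Lambda_commutation: "Omega \<star> \<Lambda>\<^bsub>n\<^esub> - \<Lambda>\<^bsub>-n\<^esub> \<star> Omega = \<O>\<^bsub>n\<^esub>"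
  by (intro ext) (auto simp: mat_mult_Lambda Lambda_mat_mult Omega_entry Omat_entry)

text \<open>\<open>Omega - Omega_bar\<close> is the full antidiagonal matrix J, and J Lambda_n =
  Lambda_{-n} J, so the commutator is the same as for \<open>Omega\<close>.\<close>

lemma Omega_bar_Lambda_commutation: "Omega_bar \<star> \<Lambda>\<^bsub>n\<^esub> - \<Lambda>\<^bsub>-n\<^esub> \<star> Omega_bar = \<O>\<^bsub>n\<^esub>"
  by (intro ext) (auto simp: mat_mult_Lambda Lambda_mat_mult Omega_bar_entry Omat_entry)

text \<open>Lambda_n E and E Lambda_n cancel. By \<open>comm\<close>, U W Lambda_n = U Lambda_{-n} W
  + U O_n, whose last term cancels the one from -U O_n E. The computation is entrywise because
  \<open>Sum_any\<close> products need not be associative.\<close>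

lemma dressed_flow:
  assumes W: "antidiagonal W" and comm: "W \<star> \<Lambda>\<^bsub>n\<^esub> - \<Lambda>\<^bsub>-n\<^esub> \<star> W = \<O>\<^bsub>n\<^esub>"
  shows "(\<Lambda>\<^bsub>n\<^esub> - U \<star> \<O>\<^bsub>n\<^esub>) \<star> (unit_mat - U \<star> W) - (unit_mat - U \<star> W) \<star> \<Lambda>\<^bsub>n\<^esub>
       = - ((\<Lambda>\<^bsub>n\<^esub> \<star> U - U \<star> \<Lambda>\<^bsub>-n\<^esub> - U \<star> \<O>\<^bsub>n\<^esub> \<star> U) \<star> W)"
proof (intro ext)
  fix i j
  let ?w = "W (- j - 1) j"
  \<comment> \<open>This is U O_n = U W Lambda_n - U Lambda_{-n} W at (i, j), with every product
    collapsed to a single term.\<close>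
  have UO: "(U \<star> \<O>\<^bsub>n\<^esub>) i j = U i (n - j - 1) * W (n - j - 1) (j - n) - U i (n - j - 1) * ?w"
  proof -
    have "n - j - 1 + - n = - j - 1"
      by simp
    then show ?thesis
      unfolding mat_mult_Omat unfolding comm[symmetric]
      by (simp only: fun_diff_def mat_mult_Lambda Lambda_mat_mult right_diff_distrib)
  qed
  have UOg: "(U \<star> \<O>\<^bsub>n\<^esub> \<star> (unit_mat - U \<star> W)) i j
      = (U \<star> \<O>\<^bsub>n\<^esub>) i j - (U \<star> \<O>\<^bsub>n\<^esub> \<star> U) i (- j - 1) * ?w"
  proof -
    \<comment> \<open>Associativity in the one place where a genuine sum occurs: the finite row of U
      O_n allows the scalar \<open>?w\<close> to be pulled out.\<close>
    have "(U \<star> \<O>\<^bsub>n\<^esub> \<star> (U \<star> W)) i j = (U \<star> \<O>\<^bsub>n\<^esub> \<star> U) i (- j - 1) * ?w"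
    proof -
      let ?F = "{m. (U \<star> \<O>\<^bsub>n\<^esub>) i m \<noteq> 0}"
      have "(U \<star> \<O>\<^bsub>n\<^esub> \<star> X) i c = (\<Sum>m\<in>?F. (U \<star> \<O>\<^bsub>n\<^esub>) i m * X m c)"
        for X :: "(int, int, _) mat" and c
        unfolding mat_mult_def[of "U \<star> \<O>\<^bsub>n\<^esub>" X]
        by (rule Sum_any.expand_superset[OF finite_row_mat_mult_Omat]) auto
      then show ?thesis
        by (simp add: mat_mult_antidiagonal[OF W] sum_distrib_right mult.assoc)
    qed
    then show ?thesis
      by (simp add: mat_mult_diff_right finite_row_mat_mult_Omat mat_mult_unit_right)
  qed
  have col: "- (j - n) - 1 = n - j - 1"
    by simp
  \<comment> \<open>Entrywise form of Lambda_n E = E Lambda_n.\<close>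
  have unit: "(unit_mat :: (int, int, 'a) mat) (i + n) j = unit_mat i (j - n)"
    by (auto simp: unit_mat_def)
  show "((\<Lambda>\<^bsub>n\<^esub> - U \<star> \<O>\<^bsub>n\<^esub>) \<star> (unit_mat - U \<star> W) - (unit_mat - U \<star> W) \<star> \<Lambda>\<^bsub>n\<^esub>) i j
      = (- ((\<Lambda>\<^bsub>n\<^esub> \<star> U - U \<star> \<Lambda>\<^bsub>-n\<^esub> - U \<star> \<O>\<^bsub>n\<^esub> \<star> U) \<star> W)) i j"
    by (simp add: mat_mult_diff_left finite_row_Lambda finite_row_mat_mult_Omat UOg UO
        Lambda_mat_mult mat_mult_Lambda mat_mult_antidiagonal[OF W] unit col algebra_simps)
qed

text \<open>Column j of E - U W is column j of E minus w times column -j-1 of U, where w =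
  \<open>W (- j - 1) j\<close>. If w = 0, the column is constant and imposes no condition; if w is 1
  or -1, it is its own inverse and U can be recovered.\<close>

lemma has_time_derivative_dressed_iff:
  assumes W: "antidiagonal W" and unit: "\<And>j. W (- j - 1) j \<in> {-1, 0, 1}"
  shows "has_time_derivative (\<lambda>t. unit_mat - U t \<star> W) n t (- (V \<star> W)) \<longleftrightarrow>
    (\<forall>i j. W (- j - 1) j \<noteq> 0 \<longrightarrow>
      ((\<lambda>s. U (t(n := s)) i (- j - 1)) has_field_derivative V i (- j - 1)) (at (t n)))"
proof -
  have "((\<lambda>s. (unit_mat - U (t(n := s)) \<star> W) i j) has_field_derivative (- (V \<star> W)) i j) (at (t n))
    \<longleftrightarrow> (W (- j - 1) j \<noteq> 0 \<longrightarrow>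
      ((\<lambda>s. U (t(n := s)) i (- j - 1)) has_field_derivative V i (- j - 1)) (at (t n)))"
    (is "?L \<longleftrightarrow> ?R") for i j
  proof (cases "W (- j - 1) j = 0")
    case True
    then show ?thesis
      by (simp add: mat_mult_antidiagonal[OF W])
  next
    case False
    let ?w = "W (- j - 1) j" and ?e = "(unit_mat :: (int, int, 'a) mat) i j"
    have w2: "x * ?w * ?w = x" for x
      using unit[of j] False by auto
    have L: "?L \<longleftrightarrow> ((\<lambda>s. ?e - U (t(n := s)) i (- j - 1) * ?w)
        has_field_derivative - (V i (- j - 1) * ?w)) (at (t n))"
      by (simp add: mat_mult_antidiagonal[OF W])
    show ?thesis
    proof
      assume ?L
      \<comment> \<open>Since w * w = 1, the entry of U is (e - (e - u w)) w, a constant-coefficient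
        expression in the entry known to be differentiable.\<close>
      then have "((\<lambda>s. (?e - (?e - U (t(n := s)) i (- j - 1) * ?w)) * ?w)
          has_field_derivative (0 - - (V i (- j - 1) * ?w)) * ?w) (at (t n))"
        unfolding L by (intro DERIV_cmult_right DERIV_diff DERIV_const)
      then show ?R
        by (simp add: w2)
    next
      assume ?R
      then have "((\<lambda>s. ?e - U (t(n := s)) i (- j - 1) * ?w)
          has_field_derivative 0 - V i (- j - 1) * ?w) (at (t n))"
        using False by (intro DERIV_cmult_right DERIV_diff DERIV_const) auto
      then show ?L
        unfolding L by simp
    qed
  qed
  then show ?thesis
    unfolding has_time_derivative_def by simp
qed

text \<open>The nonzero columns j < 0 of \<open>Omega\<close> reach the columns of U with index >=
  0, and the nonzero columns j >= 0 of \<open>Omega_bar\<close> reach those with negative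
  index.\<close>

lemma has_time_derivative_iff_dressed:
  "has_time_derivative U n t V \<longleftrightarrow>
    has_time_derivative (g_mat U) n t (- (V \<star> Omega)) \<and>
    has_time_derivative (g_bar U) n t (- (V \<star> Omega_bar))"
proof -
  let ?d = "\<lambda>i m. ((\<lambda>s. U (t(n := s)) i m) has_field_derivative V i m) (at (t n))"
  have "has_time_derivative (g_mat U) n t (- (V \<star> Omega)) \<longleftrightarrow> (\<forall>i j. j < 0 \<longrightarrow> ?d i (- j - 1))"
    unfolding g_mat_def
    by (subst has_time_derivative_dressed_iff[OF antidiagonal_Omega]) (auto simp: Omega_entry)
  moreover have "has_time_derivative (g_bar U) n t (- (V \<star> Omega_bar)) \<longleftrightarrow>
      (\<forall>i j. j \<ge> 0 \<longrightarrow> ?d i (- j - 1))"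
    unfolding g_bar_def
    by (subst has_time_derivative_dressed_iff[OF antidiagonal_Omega_bar])
      (auto simp: Omega_bar_entry)
  moreover have "(\<forall>i m. ?d i m) \<longleftrightarrow>
      (\<forall>i j. j < 0 \<longrightarrow> ?d i (- j - 1)) \<and> (\<forall>i j. j \<ge> 0 \<longrightarrow> ?d i (- j - 1))"
  proof (intro iffI allI)
    fix i m
    assume "(\<forall>i j. j < 0 \<longrightarrow> ?d i (- j - 1)) \<and> (\<forall>i j. j \<ge> 0 \<longrightarrow> ?d i (- j - 1))"
    \<comment> \<open>The reflection j -> -j-1 is an involution, so column m is reached from j =
      -m-1.\<close>
    then have "?d i (- (- m - 1) - 1)"
      by (metis linorder_not_less)
    then show "?d i m"
      by simp
  qed blast
  ultimately show ?thesis
    unfolding has_time_derivative_def by simp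
qed

lemma mat_mult_side_by_side: "A \<star> side_by_side B C = side_by_side (A \<star> B) (A \<star> C)"
  by (intro ext) (simp add: mat_mult_def side_by_side_def split: sum.split)

text \<open>Each column of the block-diagonal matrix has one nonzero entry, lying in its own block,
  so the sum over the disjoint union has a single term.\<close>

lemma side_by_side_block_diag_Lambda:
  "side_by_side A B \<star> block_diag \<Lambda>\<^bsub>k\<^esub> \<Lambda>\<^bsub>k\<^esub> = side_by_side (A \<star> \<Lambda>\<^bsub>k\<^esub>) (B \<star> \<Lambda>\<^bsub>k\<^esub>)"
proof (intro ext)
  fix i j
  show "(side_by_side A B \<star> block_diag \<Lambda>\<^bsub>k\<^esub> \<Lambda>\<^bsub>k\<^esub>) i j = side_by_side (A \<star> \<Lambda>\<^bsub>k\<^esub>) (B \<star> \<Lambda>\<^bsub>k\<^esub>) i j"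
  proof (cases j)
    case (Inl c)
    have "block_diag \<Lambda>\<^bsub>k\<^esub> \<Lambda>\<^bsub>k\<^esub> m (Inl c) = 0" if "m \<noteq> Inl (c - k)" for m
      using that by (cases m) (auto simp: Lambda_entry)
    then show ?thesis
      unfolding Inl
      by (subst mat_mult_single_column[of "Inl (c - k)"])
        (simp_all add: side_by_side_def mat_mult_Lambda Lambda_entry)
  next
    case (Inr c)
    have "block_diag \<Lambda>\<^bsub>k\<^esub> \<Lambda>\<^bsub>k\<^esub> m (Inr c) = 0" if "m \<noteq> Inr (c - k)" for m
      using that by (cases m) (auto simp: Lambda_entry)
    then show ?thesis
      unfolding Inr
      by (subst mat_mult_single_column[of "Inr (c - k)"])
        (simp_all add: side_by_side_def mat_mult_Lambda Lambda_entry)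
  qed
qed

lemma side_by_side_diff: "side_by_side A B - side_by_side C D = side_by_side (A - C) (B - D)"
  by (intro ext) (simp add: side_by_side_def split: sum.split)

lemma has_time_derivative_side_by_side:
  "has_time_derivative (\<lambda>t. side_by_side (F t) (G t)) n t (side_by_side F' G') \<longleftrightarrow>
    has_time_derivative F n t F' \<and> has_time_derivative G n t G'"
  by (auto simp: has_time_derivative_def side_by_side_def split_sum_all)

theorem mainTheorem6:
  fixes D :: "(int \<Rightarrow> 'a::real_normed_field) set"
    and U :: "(int \<Rightarrow> 'a) \<Rightarrow> (int, int, 'a) mat"
  assumes "time_domain D"
  shows "((\<forall>k\<ge>1. \<forall>n\<in>{k, -k}. \<forall>t\<in>D.
              has_time_derivative U n t
                (\<Lambda>\<^bsub>n\<^esub> \<star> U t - U t \<star> \<Lambda>\<^bsub>-n\<^esub> - U t \<star> \<O>\<^bsub>n\<^esub> \<star> U t))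
          \<longleftrightarrow>
          (\<forall>k\<ge>1. \<forall>n\<in>{k, -k}. \<forall>t\<in>D.
              has_time_derivative (g_mat U) n t
                ((\<Lambda>\<^bsub>n\<^esub> - U t \<star> \<O>\<^bsub>n\<^esub>) \<star> g_mat U t - g_mat U t \<star> \<Lambda>\<^bsub>n\<^esub>) \<and>
              has_time_derivative (g_bar U) n t
                ((\<Lambda>\<^bsub>n\<^esub> - U t \<star> \<O>\<^bsub>n\<^esub>) \<star> g_bar U t - g_bar U t \<star> \<Lambda>\<^bsub>n\<^esub>)))
       \<and> ((\<forall>k\<ge>1. \<forall>n\<in>{k, -k}. \<forall>t\<in>D.
              has_time_derivative (g_mat U) n t
                ((\<Lambda>\<^bsub>n\<^esub> - U t \<star> \<O>\<^bsub>n\<^esub>) \<star> g_mat U t - g_mat U t \<star> \<Lambda>\<^bsub>n\<^esub>) \<and>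
              has_time_derivative (g_bar U) n t
                ((\<Lambda>\<^bsub>n\<^esub> - U t \<star> \<O>\<^bsub>n\<^esub>) \<star> g_bar U t - g_bar U t \<star> \<Lambda>\<^bsub>n\<^esub>))
          \<longleftrightarrow>
          (\<forall>k\<ge>1. \<forall>n\<in>{k, -k}. \<forall>t\<in>D.
              has_time_derivative (eta2 U) n t
                ((\<Lambda>\<^bsub>n\<^esub> - U t \<star> \<O>\<^bsub>n\<^esub>) \<star> eta2 U t - eta2 U t \<star> block_diag \<Lambda>\<^bsub>n\<^esub> \<Lambda>\<^bsub>n\<^esub>)))"
proof -
  let ?V = "\<lambda>n t. \<Lambda>\<^bsub>n\<^esub> \<star> U t - U t \<star> \<Lambda>\<^bsub>-n\<^esub> - U t \<star> \<O>\<^bsub>n\<^esub> \<star> U t"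
  have g: "(\<Lambda>\<^bsub>n\<^esub> - U t \<star> \<O>\<^bsub>n\<^esub>) \<star> g_mat U t - g_mat U t \<star> \<Lambda>\<^bsub>n\<^esub> = - (?V n t \<star> Omega)" for n t
    unfolding g_mat_def by (rule dressed_flow[OF antidiagonal_Omega Omega_Lambda_commutation])
  have g_bar: "(\<Lambda>\<^bsub>n\<^esub> - U t \<star> \<O>\<^bsub>n\<^esub>) \<star> g_bar U t - g_bar U t \<star> \<Lambda>\<^bsub>n\<^esub> = - (?V n t \<star> Omega_bar)" for n t
    unfolding g_bar_def
    by (rule dressed_flow[OF antidiagonal_Omega_bar Omega_bar_Lambda_commutation])
  have eta: "has_time_derivative (eta2 U) n t
      ((\<Lambda>\<^bsub>n\<^esub> - U t \<star> \<O>\<^bsub>n\<^esub>) \<star> eta2 U t - eta2 U t \<star> block_diag \<Lambda>\<^bsub>n\<^esub> \<Lambda>\<^bsub>n\<^esub>) \<longleftrightarrow>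
      has_time_derivative (g_mat U) n t
        ((\<Lambda>\<^bsub>n\<^esub> - U t \<star> \<O>\<^bsub>n\<^esub>) \<star> g_mat U t - g_mat U t \<star> \<Lambda>\<^bsub>n\<^esub>) \<and>
      has_time_derivative (g_bar U) n t
        ((\<Lambda>\<^bsub>n\<^esub> - U t \<star> \<O>\<^bsub>n\<^esub>) \<star> g_bar U t - g_bar U t \<star> \<Lambda>\<^bsub>n\<^esub>)" for n t
    unfolding eta2_def mat_mult_side_by_side side_by_side_block_diag_Lambda side_by_side_diff
    by (rule has_time_derivative_side_by_side)
  show ?thesis
    \<comment> \<open>Both equivalences hold for each n and t separately: \<open>eta\<close> makes
      the second one trivial, and \<open>g\<close> and \<open>g_bar\<close> bring the first to the
      form -V W.\<close>
    unfolding eta unfolding g g_bar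
    by (simp only: has_time_derivative_iff_dressed[of U])
qed

end
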